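(* Let $\mathbf L=(L,\vee,\wedge,* )$ be a sectionally pseudocomplemented lattice with greatest element $1$ and $F\subseteq L$. Then $F\in\operatorname{Fil}\mathbf L$ if and only if $F$ is closed with respect to the following ideal terms: \begin{align*} t_1 & :=1, \\ t_2(x_1,x_2,x_3,y_1,y_2) & :=(((x_1\vee x_2)\wedge(y_1*x_2)\wedge y_2)\vee x_3)*(x_2\vee x_3), \\ t_3(x_1,x_2,x_3,y_1,y_2) & :=(((x_1\vee x_2)\wedge(y_1*x_2)\wedge y_2)\wedge x_3)*(x_2\wedge x_3), \\ t_4(x_1,x_2,x_3,y_1,y_2) & :=(((x_1\vee x_2)\wedge(y_1*x_2)\wedge y_2)*x_3)*(x_2*x_3), \\ t_5(x_1,x_2,x_3,y_1,y_2) & :=(x_3*x_1)*(x_3*((x_1\vee x_2)\wedge(y_2*x_1)\wedge y_1)). \end{align*}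
   Context: A lattice $(L,\vee,\wedge)$ is sectionally pseudocomplemented if for all $a,b\in L$ there exists a greatest element $c$ of $L$ satisfying $(a\vee b)\wedge c=b$; this $c$ is denoted by $a*b$. Sectionally pseudocomplemented lattices are regarded as algebras $(L,\vee,\wedge,* )$ of type $(2,2,2)$. Only non-empty lattices are considered; then there is a greatest element $1$ (namely $x*x=1$ for every $x\in L$). A filter of $\mathbf L$ is a subset $F$ of $L$ containing $1$ such that, for all $x,y,z\in L$, $x*y,y*x\in F$ implies $(x\vee z)*(y\vee z),\ (x\wedge z)*(y\wedge z),\ (x*z)*(y*z),\ (z*x)*(z*y)\in F$. $\operatorname{Fil}\mathbf L$ is the set of all filters of $\mathbf L$. An ideal term is a term $t(x_1,\ldots,x_n,y_1,\ldots,y_m)$ in the language of sectionally pseudocomplemented lattices satisfying the identity $t(x_1,\ldots,x_n,1,\ldots,1)\approx1$. A subset $A\subseteq L$ is closed with respect to ideal terms $t_i(x_1,\ldots,x_n,y_1,\ldots,y_m)$, $i\in I$, if for every $i\in I$, all $x_1,\ldots,x_n\in L$ and all $y_1,\ldots,y_m\in A$ one has $t_i(x_1,\ldots,x_n,y_1,\ldots,y_m)\in A$ (for $t_1$ this means $1\in A$). *)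

theory Defs
  imports Main
begin

unbundle lattice_syntax

text \<open>
  The greatest element exists in every non-empty sectionally pseudocomplemented lattice,
  since \<open>(x \<squnion> x) \<sqinter> c = x\<close> means \<open>x \<le> c\<close>, so that \<open>x \<star> x\<close> is the greatest element. Hence basing the
  class on \<^class>\<open>bounded_lattice_top\<close> only supplies the name \<open>\<top>\<close> for the element \<open>1\<close>.
\<close>

class sectionally_pseudocomplemented_lattice = bounded_lattice_top +
  assumes sectional_pseudocomplement_exists:
    "\<exists>c. (a \<squnion> b) \<sqinter> c = b \<and> (\<forall>d. (a \<squnion> b) \<sqinter> d = b \<longrightarrow> d \<le> c)"

definition spc :: "'a::sectionally_pseudocomplemented_lattice \<Rightarrow> 'a \<Rightarrow> 'a"  (infixl "\<star>" 75)
  where "a \<star> b = (GREATEST c. (a \<squnion> b) \<sqinter> c = b)"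

definition Fil :: "'a::sectionally_pseudocomplemented_lattice set set" where
  "Fil = {F. \<top> \<in> F \<and>
     (\<forall>x y z. x \<star> y \<in> F \<and> y \<star> x \<in> F \<longrightarrow>
        (x \<squnion> z) \<star> (y \<squnion> z) \<in> F \<and>
        (x \<sqinter> z) \<star> (y \<sqinter> z) \<in> F \<and>
        (x \<star> z) \<star> (y \<star> z) \<in> F \<and>
        (z \<star> x) \<star> (z \<star> y) \<in> F)}"

text \<open>
  Terms over two sorts of variables \<open>x\<^sub>i = X i\<close> and \<open>y\<^sub>i = Y i\<close>. The constant \<open>One\<close> stands for the
  element \<open>1 = x \<star> x\<close>, which is not among the basic operations but is used as a nullary term.
\<close>

datatype spl_term =
    X nat
  | Y nat
  | One
  | Join spl_term spl_term  (infixl "\<^bold>\<or>" 65)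
  | Meet spl_term spl_term  (infixl "\<^bold>\<and>" 70)
  | Star spl_term spl_term  (infixl "\<^bold>\<star>" 75)

primrec eval_term ::
  "(nat \<Rightarrow> 'a::sectionally_pseudocomplemented_lattice) \<Rightarrow> (nat \<Rightarrow> 'a) \<Rightarrow> spl_term \<Rightarrow> 'a"
where
  "eval_term x y (X i) = x i"
| "eval_term x y (Y i) = y i"
| "eval_term x y One = \<top>"
| "eval_term x y (s \<^bold>\<or> t) = eval_term x y s \<squnion> eval_term x y t"
| "eval_term x y (s \<^bold>\<and> t) = eval_term x y s \<sqinter> eval_term x y t"
| "eval_term x y (s \<^bold>\<star> t) = eval_term x y s \<star> eval_term x y t"

primrec y_vars :: "spl_term \<Rightarrow> nat set" where
  "y_vars (X i) = {}"
| "y_vars (Y i) = {i}"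
| "y_vars One = {}"
| "y_vars (s \<^bold>\<or> t) = y_vars s \<union> y_vars t"
| "y_vars (s \<^bold>\<and> t) = y_vars s \<union> y_vars t"
| "y_vars (s \<^bold>\<star> t) = y_vars s \<union> y_vars t"

text \<open>
  The type argument ranges over the lattices in which the identity is tested: a theorem about
  \<open>ideal_term TYPE('b) t\<close> for a type variable \<open>'b\<close> says that the identity holds in every
  sectionally pseudocomplemented lattice.
\<close>

definition ideal_term :: "'b::sectionally_pseudocomplemented_lattice itself \<Rightarrow> spl_term \<Rightarrow> bool" where
  "ideal_term _ t \<longleftrightarrow> (\<forall>x :: nat \<Rightarrow> 'b. eval_term x (\<lambda>_. \<top>) t = \<top>)"

text \<open>
  Only the variables \<open>y\<^sub>i\<close> occurring in \<open>t\<close> are required to take values in \<open>A\<close>. Requiring this of all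
  \<open>y\<^sub>i\<close> would make the condition vacuous for \<open>A = {}\<close>, even for the nullary term \<open>One\<close>.
\<close>

definition closed_wrt :: "'a::sectionally_pseudocomplemented_lattice set \<Rightarrow> spl_term set \<Rightarrow> bool" where
  "closed_wrt A T \<longleftrightarrow>
     (\<forall>t\<in>T. \<forall>x y. (\<forall>i\<in>y_vars t. y i \<in> A) \<longrightarrow> eval_term x y t \<in> A)"

definition t1 :: spl_term where
  "t1 = One"

definition t2 :: spl_term where
  "t2 = (((X 1 \<^bold>\<or> X 2) \<^bold>\<and> (Y 1 \<^bold>\<star> X 2) \<^bold>\<and> Y 2) \<^bold>\<or> X 3) \<^bold>\<star> (X 2 \<^bold>\<or> X 3)"

definition t3 :: spl_term where
  "t3 = (((X 1 \<^bold>\<or> X 2) \<^bold>\<and> (Y 1 \<^bold>\<star> X 2) \<^bold>\<and> Y 2) \<^bold>\<and> X 3) \<^bold>\<star> (X 2 \<^bold>\<and> X 3)"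

definition t4 :: spl_term where
  "t4 = (((X 1 \<^bold>\<or> X 2) \<^bold>\<and> (Y 1 \<^bold>\<star> X 2) \<^bold>\<and> Y 2) \<^bold>\<star> X 3) \<^bold>\<star> (X 2 \<^bold>\<star> X 3)"

definition t5 :: spl_term where
  "t5 = (X 3 \<^bold>\<star> X 1) \<^bold>\<star> (X 3 \<^bold>\<star> ((X 1 \<^bold>\<or> X 2) \<^bold>\<and> (Y 2 \<^bold>\<star> X 1) \<^bold>\<and> Y 1))"

end

theory Submission
  imports Defs
begin

text \<open>
  Write \<open>x \<Theta> y\<close> for \<open>x \<star> y, y \<star> x \<in> F\<close>. A term \<open>t\<^sub>i\<close> compares the images of \<open>w\<close> and \<open>b\<close>
  under a basic operation, where \<open>w = (a \<squnion> b) \<sqinter> (p \<star> b) \<sqinter> q\<close>. For \<open>p = x \<star> y\<close>, \<open>q = y \<star> x\<close>,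
  \<open>a = x\<close>, \<open>b = y\<close> one has \<open>w = x\<close>, so that closedness under the terms yields the filter
  conditions. Conversely \<open>p \<le> w \<star> b\<close> and \<open>q \<le> b \<star> w\<close>; as filters are upward closed,
  \<open>p, q \<in> F\<close> gives \<open>w \<Theta> b\<close> directly. Transitivity of \<open>\<Theta>\<close> is not available: it fails for
  the filter of all nonzero elements of the four-element Boolean lattice.
\<close>

lemma spc_greatest:
  "(a \<squnion> b) \<sqinter> (a \<star> b) = b \<and> (\<forall>d. (a \<squnion> b) \<sqinter> d = b \<longrightarrow> d \<le> a \<star> b)"
proof -
  obtain c where c: "(a \<squnion> b) \<sqinter> c = b" "\<And>d. (a \<squnion> b) \<sqinter> d = b \<Longrightarrow> d \<le> c"
    using sectional_pseudocomplement_exists by blast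
  then have "a \<star> b = c"
    unfolding spc_def by (intro Greatest_equality)
  with c show ?thesis by simp
qed

lemma inf_spc: "(a \<squnion> b) \<sqinter> (a \<star> b) = b"
  using spc_greatest by blast

lemma le_spcI: "(a \<squnion> b) \<sqinter> c = b \<Longrightarrow> c \<le> a \<star> b"
  using spc_greatest by blast

lemma le_spc: "b \<le> a \<star> b"
  by (rule le_spcI) (simp add: inf_absorb2)

lemma spc_eq_top: "a \<le> b \<Longrightarrow> a \<star> b = \<top>"
  by (metis inf_top_right le_spcI sup_absorb2 top_unique)

lemma top_spc: "\<top> \<star> b = b"
  using inf_spc[of \<top> b] by simp

text \<open>Since \<open>y \<le> x \<star> y\<close>, the defining equation of
  \<open>x \<star> y\<close>, read with its two factors exchanged, makes
  \<open>x \<squnion> y\<close> a candidate for \<open>(x \<star> y) \<star> y\<close>.\<close>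

lemma sup_le_spc_spc: "x \<squnion> y \<le> (x \<star> y) \<star> y"
proof (rule le_spcI)
  have "x \<star> y \<squnion> y = x \<star> y"
    by (simp add: le_spc sup_absorb1)
  then show "(x \<star> y \<squnion> y) \<sqinter> (x \<squnion> y) = y"
    using inf_spc[of x y] by (simp add: inf_commute)
qed

text \<open>The middle factor lies above \<open>x \<squnion> y\<close> and is absorbed; what remains
  is the defining equation of \<open>y \<star> x\<close>.\<close>

lemma spc_recover: "(x \<squnion> y) \<sqinter> ((x \<star> y) \<star> y) \<sqinter> (y \<star> x) = x"
proof -
  have "(x \<squnion> y) \<sqinter> ((x \<star> y) \<star> y) = x \<squnion> y"
    by (intro inf_absorb1 sup_le_spc_spc)
  then show ?thesis
    using inf_spc[of y x] by (simp add: sup_commute)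
qed

text \<open>Both \<open>?w\<close> and \<open>b\<close> lie below \<open>p \<star> b\<close>, hence
  so does their join, and the meet of \<open>p \<squnion> b\<close> with \<open>p \<star> b\<close>
  is \<open>b\<close>. No distributivity enters.\<close>

lemma le_spc_left:
  fixes a b p q :: "'a::sectionally_pseudocomplemented_lattice"
  shows "p \<le> ((a \<squnion> b) \<sqinter> (p \<star> b) \<sqinter> q) \<star> b"
proof -
  let ?w = "(a \<squnion> b) \<sqinter> (p \<star> b) \<sqinter> q"
  have "?w \<le> p \<star> b"
    by (simp add: le_infI1)
  then have "?w \<squnion> b \<le> p \<star> b"
    by (simp add: le_spc)
  then have "(?w \<squnion> b) \<sqinter> (p \<squnion> b) \<le> (p \<squnion> b) \<sqinter> (p \<star> b)"
    by (metis inf_commute inf_mono order_refl)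
  then have "(?w \<squnion> b) \<sqinter> (p \<squnion> b) = b"
    by (simp add: inf_spc antisym)
  \<comment> \<open>A solution of the defining equation must lie above \<open>b\<close>, so the
    candidate is \<open>p \<squnion> b\<close> instead of \<open>p\<close>.\<close>
  then have "p \<squnion> b \<le> ?w \<star> b"
    by (rule le_spcI)
  then show ?thesis by simp
qed

text \<open>As \<open>b \<le> ?d\<close>, joining \<open>b\<close> to \<open>?d \<sqinter> q\<close>
  stays below \<open>?d\<close>, so meeting with \<open>q\<close> leads back to
  \<open>?d \<sqinter> q\<close>.\<close>

lemma le_spc_right:
  fixes a b p q :: "'a::sectionally_pseudocomplemented_lattice"
  shows "q \<le> b \<star> ((a \<squnion> b) \<sqinter> (p \<star> b) \<sqinter> q)"
proof (rule le_spcI)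
  let ?d = "(a \<squnion> b) \<sqinter> (p \<star> b)"
  have "b \<squnion> ?d \<sqinter> q \<le> ?d"
    by (simp add: le_spc le_infI1)
  then have "(b \<squnion> ?d \<sqinter> q) \<sqinter> q \<le> ?d \<sqinter> q"
    by (rule inf_mono) simp
  then show "(b \<squnion> ?d \<sqinter> q) \<sqinter> q = ?d \<sqinter> q"
    by (rule antisym) simp
qed

text \<open>Joining \<open>y\<close> to the pair \<open>\<top>\<close>, \<open>x\<close> gives
  \<open>\<top> \<star> y\<close>, which is \<open>y\<close>.\<close>

lemma Fil_upward:
  assumes "F \<in> Fil" "x \<in> F" "x \<le> y"
  shows "y \<in> F"
proof -
  have "\<top> \<star> x \<in> F" "x \<star> \<top> \<in> F"
    using assms by (simp_all add: top_spc spc_eq_top Fil_def)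
  then have "(\<top> \<squnion> y) \<star> (x \<squnion> y) \<in> F"
    using \<open>F \<in> Fil\<close> unfolding Fil_def by blast
  then show ?thesis
    using \<open>x \<le> y\<close> by (simp add: top_spc sup_absorb2)
qed

text \<open>Removes the term syntax: all of \<open>t2\<close> to \<open>t5\<close> are conditions on
  the same element \<open>w\<close>.\<close>

lemma closed_wrt_iff:
  "closed_wrt F {t1, t2, t3, t4, t5} \<longleftrightarrow> \<top> \<in> F \<and>
     (\<forall>p\<in>F. \<forall>q\<in>F. \<forall>a b c.
        let w = (a \<squnion> b) \<sqinter> (p \<star> b) \<sqinter> q in
        (w \<squnion> c) \<star> (b \<squnion> c) \<in> F \<and> (w \<sqinter> c) \<star> (b \<sqinter> c) \<in> F \<and>
        (w \<star> c) \<star> (b \<star> c) \<in> F \<and> (c \<star> b) \<star> (c \<star> w) \<in> F)"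
  (is "?C \<longleftrightarrow> ?R")
proof
  assume C: ?C
  have eval: "eval_term x y t \<in> F"
    if "t \<in> {t1, t2, t3, t4, t5}" "\<forall>i\<in>y_vars t. y i \<in> F" for t x y
    using C that unfolding closed_wrt_def by blast
  have "\<top> \<in> F"
    using eval[of t1] by (simp add: t1_def)
  moreover have "let w = (a \<squnion> b) \<sqinter> (p \<star> b) \<sqinter> q in
        (w \<squnion> c) \<star> (b \<squnion> c) \<in> F \<and> (w \<sqinter> c) \<star> (b \<sqinter> c) \<in> F \<and>
        (w \<star> c) \<star> (b \<star> c) \<in> F \<and> (c \<star> b) \<star> (c \<star> w) \<in> F"
    if "p \<in> F" "q \<in> F" for p q a b c
  proof -
    \<comment> \<open>The else branches supply the values at index 3 for \<open>X\<close> and at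
      index 2 for \<open>Y\<close>.\<close>
    let ?x = "\<lambda>i::nat. if i = 1 then a else if i = 2 then b else c"
    let ?y = "\<lambda>i::nat. if i = 1 then p else q"
    \<comment> \<open>In \<open>t\<^sub>5\<close> the roles of \<open>x\<^sub>1, x\<^sub>2\<close> and of \<open>y\<^sub>1, y\<^sub>2\<close> are interchanged.\<close>
    let ?x' = "\<lambda>i::nat. if i = 1 then b else if i = 2 then a else c"
    let ?y' = "\<lambda>i::nat. if i = 1 then q else p"
    show ?thesis
      using that eval[of t2 ?y ?x] eval[of t3 ?y ?x] eval[of t4 ?y ?x] eval[of t5 ?y' ?x']
      by (simp add: t2_def t3_def t4_def t5_def Let_def sup_commute)
  qed
  ultimately show ?R by blast
next
  assume R: ?R
  have R': "(w \<squnion> c) \<star> (b \<squnion> c) \<in> F" "(w \<sqinter> c) \<star> (b \<sqinter> c) \<in> F"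
      "(w \<star> c) \<star> (b \<star> c) \<in> F" "(c \<star> b) \<star> (c \<star> w) \<in> F"
    if "p \<in> F" "q \<in> F" "w = (a \<squnion> b) \<sqinter> (p \<star> b) \<sqinter> q" for p q a b c w
    using R that unfolding Let_def by blast+
  show ?C
    unfolding closed_wrt_def
  proof (intro ballI allI impI)
    fix t x y
    assume "t \<in> {t1, t2, t3, t4, t5}" and "\<forall>i\<in>y_vars t. y i \<in> F"
    then consider "t = t1" | "t = t2" "y 1 \<in> F" "y 2 \<in> F" | "t = t3" "y 1 \<in> F" "y 2 \<in> F"
      | "t = t4" "y 1 \<in> F" "y 2 \<in> F" | "t = t5" "y 1 \<in> F" "y 2 \<in> F"
      by (auto simp: t2_def t3_def t4_def t5_def)
    then show "eval_term x y t \<in> F"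
    proof cases
      case 1
      with R show ?thesis by (simp add: t1_def)
    next
      case 2
      then show ?thesis
        unfolding \<open>t = t2\<close> t2_def eval_term.simps by (intro R'(1)[OF _ _ refl])
    next
      case 3
      then show ?thesis
        unfolding \<open>t = t3\<close> t3_def eval_term.simps by (intro R'(2)[OF _ _ refl])
    next
      case 4
      then show ?thesis
        unfolding \<open>t = t4\<close> t4_def eval_term.simps by (intro R'(3)[OF _ _ refl])
    next
      case 5
      then show ?thesis
        unfolding \<open>t = t5\<close> t5_def eval_term.simps
        by (intro R'(4)[of "y 2" "y 1" _ "x 2"]) (simp_all add: sup_commute)
    qed
  qed
qed

theorem theorem4p8:
  fixes F :: "'a::sectionally_pseudocomplemented_lattice set"
  shows "(\<forall>t\<in>{t1, t2, t3, t4, t5}.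
            ideal_term TYPE('b::sectionally_pseudocomplemented_lattice) t) \<and>
         (F \<in> Fil \<longleftrightarrow> closed_wrt F {t1, t2, t3, t4, t5})"
proof (intro conjI iffI)
  show "\<forall>t\<in>{t1, t2, t3, t4, t5}. ideal_term TYPE('b) t"
    \<comment> \<open>With every \<open>Y i\<close> equal to \<open>\<top>\<close>, \<open>w\<close>
      collapses to \<open>X 2\<close> (in \<open>t5\<close> to \<open>X 1\<close>), and each term
      becomes some \<open>u \<star> u\<close>.\<close>
    by (simp add: ideal_term_def t1_def t2_def t3_def t4_def t5_def top_spc spc_eq_top
        inf_absorb2)
next
  assume F: "F \<in> Fil"
  have "let w = (a \<squnion> b) \<sqinter> (p \<star> b) \<sqinter> q in
        (w \<squnion> c) \<star> (b \<squnion> c) \<in> F \<and> (w \<sqinter> c) \<star> (b \<sqinter> c) \<in> F \<and>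
        (w \<star> c) \<star> (b \<star> c) \<in> F \<and> (c \<star> b) \<star> (c \<star> w) \<in> F"
    if "p \<in> F" "q \<in> F" for p q a b c
  proof -
    define w where "w = (a \<squnion> b) \<sqinter> (p \<star> b) \<sqinter> q"
    have "w \<star> b \<in> F" "b \<star> w \<in> F"
      unfolding w_def
      by (rule Fil_upward[OF F \<open>p \<in> F\<close> le_spc_left], rule Fil_upward[OF F \<open>q \<in> F\<close> le_spc_right])
    with F have "(w \<squnion> c) \<star> (b \<squnion> c) \<in> F \<and> (w \<sqinter> c) \<star> (b \<sqinter> c) \<in> F \<and>
        (w \<star> c) \<star> (b \<star> c) \<in> F \<and> (c \<star> b) \<star> (c \<star> w) \<in> F"
      by (simp add: Fil_def)
    then show ?thesis
      by (simp add: Let_def w_def)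
  qed
  then show "closed_wrt F {t1, t2, t3, t4, t5}"
    using F unfolding closed_wrt_iff by (simp add: Fil_def)
next
  assume C: "closed_wrt F {t1, t2, t3, t4, t5}"
  have "(x \<squnion> z) \<star> (y \<squnion> z) \<in> F \<and> (x \<sqinter> z) \<star> (y \<sqinter> z) \<in> F \<and>
        (x \<star> z) \<star> (y \<star> z) \<in> F \<and> (z \<star> x) \<star> (z \<star> y) \<in> F"
    if xy: "x \<star> y \<in> F" "y \<star> x \<in> F" for x y z
  proof -
    \<comment> \<open>The last conjunct comes out with \<open>x\<close> and \<open>y\<close>
      exchanged; as the hypotheses are symmetric, a second use with \<open>x\<close> and
      \<open>y\<close> swapped repairs this.\<close>
    have "(x \<squnion> z) \<star> (y \<squnion> z) \<in> F \<and> (x \<sqinter> z) \<star> (y \<sqinter> z) \<in> F \<and>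
          (x \<star> z) \<star> (y \<star> z) \<in> F \<and> (z \<star> y) \<star> (z \<star> x) \<in> F"
      if "x \<star> y \<in> F" "y \<star> x \<in> F" for x y
    proof -
      have "let w = (x \<squnion> y) \<sqinter> ((x \<star> y) \<star> y) \<sqinter> (y \<star> x) in
          (w \<squnion> z) \<star> (y \<squnion> z) \<in> F \<and> (w \<sqinter> z) \<star> (y \<sqinter> z) \<in> F \<and>
          (w \<star> z) \<star> (y \<star> z) \<in> F \<and> (z \<star> y) \<star> (z \<star> w) \<in> F"
        using C that unfolding closed_wrt_iff by blast
      then show ?thesis
        by (simp add: spc_recover)
    qed
    from this[OF xy] this[OF xy(2,1)] show ?thesis by blast
  qed
  moreover have "\<top> \<in> F"
    using C unfolding closed_wrt_iff by blast
  ultimately show "F \<in> Fil"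
    unfolding Fil_def by blast
qed

end
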